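(* For every permutation $\pi$ of $[k]$ there is a constant $C=C(\pi)$ such that for every $n\in\mathbf{N}$, every simple hypergraph $H$ with $v(H)\le n$ that avoids $P(\pi)$ satisfies $i(H)\le Cn$. In other words, $\mathrm{ex}_i(n,P(\pi))=O(n)$, where $$\mathrm{ex}_i(n,F)=\max\{i(H):\ H \text{ is simple},\ H \text{ avoids } F,\ v(H)\le n\}.$$
   Context: Let $\mathbf{N}=\{1,2,\dots\}$ and $[k]=\{1,\dots,k\}$. A hypergraph is a finite family $H=(E_i:\ i\in I)$ of finite nonempty subsets $E_i\subset\mathbf{N}$, called edges; repeated edges are allowed. $H$ is simple if it has no repeated edges. Its vertex set is $V(H)=\bigcup_{i\in I}E_i$. We write $v(H)=|V(H)|$ for the order and $i(H)=\sum_{i\in I}|E_i|$ for the weight. $H'=(E'_i:\ i\in I')$ is contained in $H=(E_i:\ i\in I)$ if there are an increasing injection $f:V(H')\to V(H)$ and an injection $g:I'\to I$ such that $f(E'_i)\subset E_{g(i)}$ for all $i\in I'$. Otherwise $H$ avoids $H'$. For a permutation $\pi=a_1a_2\dots a_k$ of $[k]$, $P(\pi)$ is the hypergraph (graph) on $[2k]$ whose edges are the $k$ two-element sets $\{i,k+a_i\}$ for $i\in[k]$. *)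

theory Defs
  imports Complex_Main "HOL-Library.Landau_Symbols" "HOL-Combinatorics.Permutations"
begin

text \<open>
  A hypergraph is a finite indexed family of finite nonempty sets of positive integers.
  Indices are natural numbers, which loses no generality because index sets are finite;
  the values of \<open>edge H\<close> outside \<open>idx H\<close> are irrelevant.
\<close>

record hgraph =
  idx :: "nat set"
  edge :: "nat \<Rightarrow> nat set"

definition hypergraph :: "hgraph \<Rightarrow> bool" where
  "hypergraph H \<longleftrightarrow> finite (idx H) \<and>
     (\<forall>i\<in>idx H. finite (edge H i) \<and> edge H i \<noteq> {} \<and> edge H i \<subseteq> {1..})"

definition simple :: "hgraph \<Rightarrow> bool" where
  "simple H \<longleftrightarrow> inj_on (edge H) (idx H)"

definition vertices :: "hgraph \<Rightarrow> nat set" where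
  "vertices H = (\<Union>i\<in>idx H. edge H i)"

definition order :: "hgraph \<Rightarrow> nat" where
  "order H = card (vertices H)"

definition weight :: "hgraph \<Rightarrow> nat" where
  "weight H = (\<Sum>i\<in>idx H. card (edge H i))"

definition contained :: "hgraph \<Rightarrow> hgraph \<Rightarrow> bool" where
  "contained H' H \<longleftrightarrow> (\<exists>f g.
     strict_mono_on (vertices H') f \<and> f ` vertices H' \<subseteq> vertices H \<and>
     inj_on g (idx H') \<and> g ` idx H' \<subseteq> idx H \<and>
     (\<forall>i\<in>idx H'. f ` edge H' i \<subseteq> edge H (g i)))"

definition avoids :: "hgraph \<Rightarrow> hgraph \<Rightarrow> bool" where
  "avoids H H' \<longleftrightarrow> \<not> contained H' H"

definition perm_graph :: "nat \<Rightarrow> (nat \<Rightarrow> nat) \<Rightarrow> hgraph" where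
  "perm_graph k \<pi> = \<lparr>idx = {1..k}, edge = (\<lambda>i. {i, k + \<pi> i})\<rparr>"

definition ex_weights :: "nat \<Rightarrow> hgraph \<Rightarrow> nat set" where
  "ex_weights n F = {weight H | H. hypergraph H \<and> simple H \<and> avoids H F \<and> order H \<le> n}"

definition ex_i :: "nat \<Rightarrow> hgraph \<Rightarrow> nat" where
  "ex_i n F = Max (ex_weights n F)"

text \<open>
  The maximum is taken over a finite set, which is nonempty as soon as \<open>F\<close> has an edge.
\<close>

lemma finite_ex_weights: "finite (ex_weights n F)"
proof -
  have "w \<le> 2 ^ n * n" if w: "w \<in> ex_weights n F" for w
  proof -
    from w obtain H where H: "w = weight H" "hypergraph H" "simple H" "order H \<le> n"
      by (auto simp: ex_weights_def)
    have finV: "finite (vertices H)"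
      using H(2) by (auto simp: hypergraph_def vertices_def)
    have sub: "edge H ` idx H \<subseteq> Pow (vertices H)"
      by (auto simp: vertices_def)
    have "card (idx H) = card (edge H ` idx H)"
      using H(3) by (simp add: simple_def card_image)
    also have "\<dots> \<le> card (Pow (vertices H))"
      by (rule card_mono) (use finV sub in auto)
    also have "\<dots> = 2 ^ order H"
      using finV by (simp add: card_Pow order_def)
    also have "\<dots> \<le> 2 ^ n"
      using H(4) by simp
    finally have c: "card (idx H) \<le> 2 ^ n" .
    have "card (edge H i) \<le> n" if "i \<in> idx H" for i
    proof -
      have "card (edge H i) \<le> card (vertices H)"
        by (rule card_mono) (use finV sub that in auto)
      then show ?thesis using H(4) by (simp add: order_def)
    qed
    then have "weight H \<le> card (idx H) * n"
      unfolding weight_def using sum_bounded_above[of "idx H" "\<lambda>i. card (edge H i)" n] by simp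
    also have "\<dots> \<le> 2 ^ n * n"
      using c by simp
    finally show ?thesis using H(1) by simp
  qed
  then show ?thesis
    using finite_nat_set_iff_bounded_le by blast
qed

lemma ex_weights_nonempty:
  assumes "idx F \<noteq> {}"
  shows "ex_weights n F \<noteq> {}"
proof -
  define H where "H = \<lparr>idx = {}, edge = (\<lambda>_. {})\<rparr>"
  have "weight H \<in> ex_weights n F"
    unfolding ex_weights_def using assms
    by (auto intro!: exI[of _ H] simp: H_def hypergraph_def simple_def avoids_def
        contained_def order_def vertices_def)
  then show ?thesis by blast
qed

lemma perm_graph_hypergraph:
  assumes "\<pi> permutes {1..k}"
  shows "hypergraph (perm_graph k \<pi>)"
    and "simple (perm_graph k \<pi>)"
    and "vertices (perm_graph k \<pi>) = {1..2 * k}"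
proof -
  have img: "\<pi> ` {1..k} = {1..k}"
    using assms by (rule permutes_image)
  have r: "1 \<le> \<pi> i \<and> \<pi> i \<le> k" if "1 \<le> i" "i \<le> k" for i
    using img that by (metis atLeastAtMost_iff imageI)
  show "hypergraph (perm_graph k \<pi>)"
    by (auto simp: hypergraph_def perm_graph_def)
  show "simple (perm_graph k \<pi>)"
    unfolding simple_def perm_graph_def inj_on_def using r by (fastforce simp: doubleton_eq_iff)
  have "vertices (perm_graph k \<pi>) = {1..k} \<union> (\<lambda>j. k + j) ` (\<pi> ` {1..k})"
    by (auto simp: vertices_def perm_graph_def)
  also have "\<dots> = {1..2 * k}"
    unfolding img by (simp only: image_add_atLeastAtMost) auto
  finally show "vertices (perm_graph k \<pi>) = {1..2 * k}" .
qed

end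

theory Submission
  imports Defs "HOL-Library.Infinite_Set"
begin

text \<open>
  By the Marcus--Tardos theorem, an ordered graph on \<open>n\<close> vertices without an ordered copy of the
  permutation has \<open>O(n)\<close> edges. Call a pair of vertices heavy if at least \<open>k\<close> edges of the
  hypergraph contain it, and light otherwise. A copy of the pattern in the graph of heavy pairs
  extends greedily to distinct hyperedges, so this graph is sparse, hence degenerate, and has only
  \<open>O(n)\<close> cliques, all of bounded size; this bounds the weight of the hyperedges all of whose pairs
  are heavy. Any other hyperedge is cut into consecutive pieces too large to be cliques, and a light
  pair is picked in each piece. Pairs picked in the same hyperedge do not interleave, so a copy of
  the pattern uses at most one of them; hence the picked pairs form a sparse graph too, and each of
  them belongs to fewer than \<open>k\<close> hyperedges.
\<close>

subsection \<open>Forbidden permutation matrices\<close>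

text \<open>A 0/1 matrix is represented by the set of positions of its ones, and this is containment
  of the permutation matrix of \<open>\<pi>\<close>.\<close>

definition matrix_contains :: "nat \<Rightarrow> (nat \<Rightarrow> nat) \<Rightarrow> (nat \<times> nat) set \<Rightarrow> bool" where
  "matrix_contains k \<pi> M \<longleftrightarrow> (\<exists>r c. strict_mono_on {1..k} r \<and> strict_mono_on {1..k} c \<and>
     (\<forall>i\<in>{1..k}. (r i, c (\<pi> i)) \<in> M))"

text \<open>For a set of pairs \<open>(x, y)\<close> with \<open>x < y\<close>, this is an ordered
  copy of the graph P(\<open>\<pi>\<close>): \<open>r\<close> places the vertices 1 to k and
  \<open>c j\<close> is the image of \<open>k + j\<close>, so every row has to precede every
  column.\<close>

definition graph_contains :: "nat \<Rightarrow> (nat \<Rightarrow> nat) \<Rightarrow> (nat \<times> nat) set \<Rightarrow> bool" where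
  "graph_contains k \<pi> G \<longleftrightarrow> (\<exists>r c. strict_mono_on {1..k} r \<and> strict_mono_on {1..k} c \<and>
     (\<forall>i\<in>{1..k}. \<forall>j\<in>{1..k}. r i < c j) \<and> (\<forall>i\<in>{1..k}. (r i, c (\<pi> i)) \<in> G))"

lemma ex_strict_mono_on_into:
  fixes S :: "nat set"
  assumes "finite S" "k \<le> card S"
  obtains r where "strict_mono_on {1..k} r" "r ` {1..k} \<subseteq> S"
proof -
  obtain h where h: "bij_betw h {..<card S} S" "strict_mono_on {..<card S} h"
    using ex_bij_betw_strict_mono_card[OF assms(1)] by metis
  have "strict_mono_on {1..k} (\<lambda>i. h (i - 1))"
    using assms(2) by (intro strict_mono_onI strict_mono_onD[OF h(2)]) auto
  moreover have "h (i - 1) \<in> S" if "i \<in> {1..k}" for i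
    using bij_betw_apply[OF h(1), of "i - 1"] that assms(2) by auto
  ultimately show ?thesis by (intro that) auto
qed

text \<open>Pigeonhole: fibres with fewer than \<open>k\<close> elements would total less than
  \<open>card B * k\<close>. The strict inequality needs \<open>B\<close> nonempty, which follows
  from \<open>A \<noteq> {}\<close>.\<close>

lemma ex_large_fibre:
  assumes "finite A" "finite B" "f ` A \<subseteq> B" "card B * k \<le> card A" "0 < k" "A \<noteq> {}"
  shows "\<exists>y\<in>B. k \<le> card {x \<in> A. f x = y}"
proof (rule ccontr)
  assume "\<not> ?thesis"
  then have *: "\<And>y. y \<in> B \<Longrightarrow> card {x \<in> A. f x = y} < k" by auto
  have "B \<noteq> {}" using assms by auto
  have "A = (\<Union>y\<in>B. {x \<in> A. f x = y})" using assms(3) by auto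
  then have "card A \<le> (\<Sum>y\<in>B. card {x \<in> A. f x = y})"
    using card_UN_le[OF assms(2)] by metis
  also have "\<dots> < (\<Sum>y\<in>B. k)"
    using * \<open>B \<noteq> {}\<close> assms(2) by (intro sum_strict_mono) auto
  finally show False using assms(4) by simp
qed

text \<open>Transposition exchanges \<open>r\<close> and \<open>c\<close> and inverts the
  permutation. This lets a bound on blocks with many columns serve for blocks with many
  rows.\<close>

lemma matrix_contains_transpose:
  assumes "\<pi> permutes {1..k}" "matrix_contains k (inv \<pi>) (M\<inverse>)"
  shows "matrix_contains k \<pi> M"
proof -
  obtain r c where rc: "strict_mono_on {1..k} r" "strict_mono_on {1..k} c"
    "\<forall>i\<in>{1..k}. (r i, c (inv \<pi> i)) \<in> M\<inverse>"
    using assms(2) unfolding matrix_contains_def by blast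
  have "(c i, r (\<pi> i)) \<in> M" if "i \<in> {1..k}" for i
  proof -
    have "\<pi> i \<in> {1..k}" using that permutes_in_image[OF assms(1)] by blast
    then show ?thesis using rc(3) permutes_inverses(2)[OF assms(1)] by (metis converse_iff)
  qed
  then show ?thesis unfolding matrix_contains_def using rc by blast
qed

lemma div_less_imp_less:
  fixes a b s :: nat
  assumes "a div s < b div s" shows "a < b"
  using assms div_le_mono[of b a s] by (meson not_less)

text \<open>A permutation matrix has a single one in each row and column, so one entry of
  \<open>M\<close> can be chosen from each block of the copy. Chosen entries lie in different block
  rows and block columns, and the order of the blocks forces the order of the entries.\<close>

lemma matrix_contains_contraction:
  assumes \<pi>: "\<pi> permutes {1..k}"
    and "matrix_contains k \<pi> ((\<lambda>(x, y). (x div s, y div s)) ` M)"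
  shows "matrix_contains k \<pi> M"
proof -
  obtain r c where rc: "strict_mono_on {1..k} r" "strict_mono_on {1..k} c"
    "\<forall>i\<in>{1..k}. (r i, c (\<pi> i)) \<in> (\<lambda>(x, y). (x div s, y div s)) ` M"
    using assms(2) unfolding matrix_contains_def by blast
  have "\<forall>i\<in>{1..k}. \<exists>p. p \<in> M \<and> fst p div s = r i \<and> snd p div s = c (\<pi> i)"
    using rc(3) by fastforce
  then obtain p where p: "\<forall>i\<in>{1..k}. p i \<in> M \<and> fst (p i) div s = r i \<and> snd (p i) div s = c (\<pi> i)"
    by metis
  have inv_in: "inv \<pi> j \<in> {1..k}" if "j \<in> {1..k}" for j
    using that permutes_in_image[OF permutes_inv[OF \<pi>]] by blast
  have inv1: "\<pi> (inv \<pi> j) = j" "inv \<pi> (\<pi> j) = j" for j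
    using permutes_inverses[OF \<pi>] by auto
  show ?thesis
    unfolding matrix_contains_def
  proof (intro exI conjI)
    show "strict_mono_on {1..k} (\<lambda>i. fst (p i))"
      using p strict_mono_onD[OF rc(1)]
      by (intro strict_mono_onI) (metis div_less_imp_less)
    \<comment> \<open>Column \<open>j\<close> of the pattern has its one in row
      \<open>inv \<pi> j\<close>, so its position is read off the entry chosen for that row.\<close>
    show "strict_mono_on {1..k} (\<lambda>j. snd (p (inv \<pi> j)))"
    proof (rule strict_mono_onI)
      fix a b assume ab: "a \<in> {1..k}" "b \<in> {1..k}" "a < b"
      have "snd (p (inv \<pi> a)) div s = c a" "snd (p (inv \<pi> b)) div s = c b"
        using p inv_in inv1 ab by metis+
      then show "snd (p (inv \<pi> a)) < snd (p (inv \<pi> b))"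
        using strict_mono_onD[OF rc(2) ab] by (metis div_less_imp_less)
    qed
    show "\<forall>i\<in>{1..k}. (fst (p i), snd (p (inv \<pi> (\<pi> i)))) \<in> M"
      using p inv1 by simp
  qed
qed

section \<open>Blocks with many nonempty columns\<close>

text \<open>Columns keep their absolute position in \<open>M\<close>, so equal sets for two blocks
  with the same \<open>b\<close> mean the same columns of \<open>M\<close>.\<close>

definition block_cols :: "nat \<Rightarrow> (nat \<times> nat) set \<Rightarrow> nat \<Rightarrow> nat \<Rightarrow> nat set" where
  "block_cols s M a b = {y. \<exists>x. (x, y) \<in> M \<and> x div s = a \<and> y div s = b}"

text \<open>Blocks with at least \<open>k\<close> nonempty rows get no definition of their own: they
  are the transposes of the wide blocks of \<open>M\<inverse>\<close>.\<close>

definition wide_blocks :: "nat \<Rightarrow> nat \<Rightarrow> (nat \<times> nat) set \<Rightarrow> (nat \<times> nat) set" where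
  "wide_blocks k s M = {(a, b). k \<le> card (block_cols s M a b)}"

lemma block_cols_subset: "0 < s \<Longrightarrow> block_cols s M a b \<subseteq> {b * s..<b * s + s}"
proof
  fix y assume "0 < s" "y \<in> block_cols s M a b"
  then have "y < s + y div s * s" "y div s = b"
    using dividend_less_div_times by (simp_all add: block_cols_def) blast
  then show "y \<in> {b * s..<b * s + s}"
    using div_times_less_eq_dividend[of y s] by simp
qed

lemma finite_block_cols: "0 < s \<Longrightarrow> finite (block_cols s M a b)"
  by (rule finite_subset[OF block_cols_subset]) auto

text \<open>
  Pigeonhole: among too many wide blocks \<open>(a, b)\<close> with the same \<open>b\<close>, some \<open>k\<close> have the same set of
  at least \<open>k\<close> nonempty columns, and then they contain every permutation of size \<open>k\<close>.
\<close>

lemma card_wide_blocks_column: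
  assumes \<pi>: "\<pi> permutes {1..k}" and nc: "\<not> matrix_contains k \<pi> M"
    and k: "0 < k" and s: "0 < s" and A: "finite A" "\<And>a. a \<in> A \<Longrightarrow> (a, b) \<in> wide_blocks k s M"
  shows "card A \<le> 2 ^ s * k"
proof (rule ccontr)
  let ?B = "Pow {b * s..<b * s + s}"
  assume "\<not> ?thesis"
  then have big: "card ?B * k \<le> card A" "A \<noteq> {}" by (auto simp: card_Pow)
  have "block_cols s M a b \<in> ?B" for a
    using block_cols_subset[OF s] by blast
  then obtain K where K: "k \<le> card {a \<in> A. block_cols s M a b = K}"
    using ex_large_fibre[OF A(1) _ _ big(1) k big(2), of "\<lambda>a. block_cols s M a b"] by auto
  obtain r where r: "strict_mono_on {1..k} r" "r ` {1..k} \<subseteq> {a \<in> A. block_cols s M a b = K}"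
    using ex_strict_mono_on_into[OF _ K] A(1) by auto
  have "1 \<in> {1..k}" using k by auto
  then have "r 1 \<in> A" "K = block_cols s M (r 1) b" using r(2) by blast+
  then have "k \<le> card K" "finite K"
    using A(2) finite_block_cols[OF s] by (auto simp: wide_blocks_def)
  then obtain c where c: "strict_mono_on {1..k} c" "c ` {1..k} \<subseteq> K"
    using ex_strict_mono_on_into by metis
  have "\<exists>x. (x, c (\<pi> i)) \<in> M \<and> x div s = r i" if "i \<in> {1..k}" for i
  proof -
    have "\<pi> i \<in> {1..k}" using that permutes_in_image[OF \<pi>] by blast
    then have "c (\<pi> i) \<in> block_cols s M (r i) b" using c r that by blast
    then show ?thesis by (auto simp: block_cols_def)
  qed
  then obtain x where x: "\<And>i. i \<in> {1..k} \<Longrightarrow> (x i, c (\<pi> i)) \<in> M \<and> x i div s = r i" by metis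
  \<comment> \<open>The rows \<open>x i\<close> lie in different block rows \<open>r i\<close>,
    whose order they inherit.\<close>
  have "strict_mono_on {1..k} x"
    using x strict_mono_onD[OF r(1)] by (intro strict_mono_onI) (metis div_less_imp_less)
  with x c(1) nc show False unfolding matrix_contains_def by blast
qed

text \<open>The bound for one block column is summed over all of them; the summand 1 allows for an
  incomplete last block.\<close>

lemma card_wide_blocks:
  assumes \<pi>: "\<pi> permutes {1..k}" and nc: "\<not> matrix_contains k \<pi> M"
    and k: "0 < k" and s: "0 < s" and M: "M \<subseteq> {..<n} \<times> {..<n}"
  shows "finite (wide_blocks k s M)" "card (wide_blocks k s M) \<le> (n div s + 1) * (2 ^ s * k)"
proof -
  let ?m = "n div s + 1"
  have sub: "wide_blocks k s M \<subseteq> {..<?m} \<times> {..<?m}"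
  proof clarify
    fix a b assume "(a, b) \<in> wide_blocks k s M"
    then have "block_cols s M a b \<noteq> {}" using k by (auto simp: wide_blocks_def)
    then obtain x y where xy: "(x, y) \<in> M" "a = x div s" "b = y div s"
      by (auto simp: block_cols_def)
    then have "x \<le> n" "y \<le> n" using M by auto
    then show "a \<in> {..<?m} \<and> b \<in> {..<?m}"
      using xy div_le_mono[of x n s] div_le_mono[of y n s] by auto
  qed
  then show fin: "finite (wide_blocks k s M)" using finite_subset by blast
  let ?A = "\<lambda>b. {a. (a, b) \<in> wide_blocks k s M}"
  have finA: "finite (?A b)" for b
    by (rule finite_subset[OF _ finite_imageI[OF fin, of fst]]) force
  have "wide_blocks k s M = (\<Union>b\<in>{..<?m}. ?A b \<times> {b})" using sub by auto
  then have "card (wide_blocks k s M) \<le> (\<Sum>b\<in>{..<?m}. card (?A b \<times> {b}))"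
    using card_UN_le[of "{..<?m}" "\<lambda>b. ?A b \<times> {b}"] by simp
  also have "\<dots> \<le> (\<Sum>b\<in>{..<?m}. 2 ^ s * k)"
    using card_wide_blocks_column[OF \<pi> nc k s finA] 
    by (intro sum_mono) (simp add: card_cartesian_product)
  finally show "card (wide_blocks k s M) \<le> ?m * (2 ^ s * k)" by simp
qed

section \<open>The recursion of Marcus and Tardos\<close>

text \<open>A block that is wide in neither direction has fewer than \<open>k\<close> nonempty rows
  and fewer than \<open>k\<close> nonempty columns, hence at most k^2 ones. Any other block has at
  most s^2.\<close>

lemma card_blocks_le:
  assumes k: "0 < k" and s: "0 < s" and M: "finite M"
    and fin: "finite (wide_blocks k s M)" "finite (wide_blocks k s (M\<inverse>))"
  shows "card M \<le> k\<^sup>2 * card ((\<lambda>(x, y). (x div s, y div s)) ` M)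
    + s\<^sup>2 * (card (wide_blocks k s M) + card (wide_blocks k s (M\<inverse>)))"
proof -
  define W where "W = wide_blocks k s M \<union> (wide_blocks k s (M\<inverse>))\<inverse>"
  define N where "N = (\<lambda>(x, y). (x div s, y div s)) ` M"
  \<comment> \<open>The entries of a block lie in the product of its nonempty rows and its nonempty
    columns; the rows are obtained as columns of the transpose.\<close>
  define bl where "bl = (\<lambda>(a, b). block_cols s (M\<inverse>) b a \<times> block_cols s M a b)"
  have finN: "finite N" using M by (simp add: N_def)
  have finW: "finite W" using fin by (simp add: W_def)
  have s_card: "card (block_cols s M' a b) \<le> s" for M' a b
    using card_mono[OF _ block_cols_subset[OF s, of M' a b]] by simp
  have fin_bl: "finite (bl p)" for p
    using finite_block_cols[OF s] by (auto simp: bl_def split: prod.splits)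
  have cov: "M \<subseteq> (\<Union>p\<in>N - W. bl p) \<union> (\<Union>p\<in>W. bl p)"
  proof clarify
    fix x y assume xy: "(x, y) \<in> M" "(x, y) \<notin> (\<Union>p\<in>W. bl p)"
    let ?p = "(x div s, y div s)"
    have "(x, y) \<in> bl ?p" "?p \<in> N"
      using xy(1) by (auto simp: bl_def block_cols_def N_def)
    then show "(x, y) \<in> (\<Union>p\<in>N - W. bl p)" using xy(2) by blast
  qed
  have "card M \<le> card ((\<Union>p\<in>N - W. bl p) \<union> (\<Union>p\<in>W. bl p))"
    using cov finN finW fin_bl by (intro card_mono) auto
  also have "\<dots> \<le> card (\<Union>p\<in>N - W. bl p) + card (\<Union>p\<in>W. bl p)" by (rule card_Un_le)
  also have "\<dots> \<le> (\<Sum>p\<in>N - W. card (bl p)) + (\<Sum>p\<in>W. card (bl p))"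
    using finN finW by (intro add_mono card_UN_le) auto
  also have "(\<Sum>p\<in>N - W. card (bl p)) \<le> (\<Sum>p\<in>N - W. k\<^sup>2)"
  proof (rule sum_mono)
    fix p assume "p \<in> N - W"
    then show "card (bl p) \<le> k\<^sup>2"
      by (auto simp: bl_def card_cartesian_product W_def wide_blocks_def power2_eq_square
          split: prod.splits intro!: mult_le_mono)
  qed
  also have "(\<Sum>p\<in>N - W. k\<^sup>2) \<le> k\<^sup>2 * card N"
    using finN by (simp add: card_mono)
  also have "(\<Sum>p\<in>W. card (bl p)) \<le> (\<Sum>p\<in>W. s\<^sup>2)"
    using s_card by (intro sum_mono)
      (auto simp: bl_def card_cartesian_product power2_eq_square split: prod.splits intro!: mult_le_mono)
  also have "(\<Sum>p\<in>W. s\<^sup>2) \<le> s\<^sup>2 * (card (wide_blocks k s M) + card (wide_blocks k s (M\<inverse>)))"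
    unfolding W_def using card_Un_le[of "wide_blocks k s M" "(wide_blocks k s (M\<inverse>))\<inverse>"]
    by (simp add: card_inverse)
  finally show ?thesis by (simp add: N_def)
qed

text \<open>Strong induction on \<open>n\<close>: the contraction of \<open>M\<close> by blocks of
  side \<open>s\<close> again avoids \<open>\<pi>\<close>, and it counts the nonempty blocks. Few
  blocks are wide in either direction, and all others contribute at most k^2 ones each.\<close>

theorem marcus_tardos:
  assumes \<pi>: "\<pi> permutes {1..k}"
  shows "\<exists>B. \<forall>n M. M \<subseteq> {..<n} \<times> {..<n} \<longrightarrow> \<not> matrix_contains k \<pi> M \<longrightarrow> card M \<le> B * n"
proof (cases "k = 0")
  case True
  then have "matrix_contains k \<pi> M" for M
    by (auto simp: matrix_contains_def intro!: strict_mono_onI)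
  then show ?thesis by blast
next
  case False
  then have k: "0 < k" by simp
  \<comment> \<open>With \<open>m\<close> blocks per side, \<open>m * s \<le> 2 * n\<close> yields
    \<open>2 * k\<^sup>2 * m \<le> n\<close>, so the inductive term takes at most half of
    \<open>B * n\<close>.\<close>
  define s where "s = 4 * k\<^sup>2"
  define A where "A = s\<^sup>2 * (2 * (2 ^ s * k))"
  \<comment> \<open>\<open>A \<le> B\<close> and \<open>2 * m \<le> n\<close> keep the contribution
    \<open>A * m\<close> of the wide blocks within the other half; the summand \<open>s\<close>
    settles the case \<open>n < s\<close>.\<close>
  define B where "B = 2 * A + s"
  have s4: "4 \<le> s" using k by (simp add: s_def)
  have "card M \<le> B * n" if "M \<subseteq> {..<n} \<times> {..<n}" "\<not> matrix_contains k \<pi> M" for n M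
    using that
  proof (induction n arbitrary: M rule: less_induct)
    case (less n)
    show ?case
    proof (cases "n < s")
      case True
      have "card M \<le> card ({..<n} \<times> {..<n})" using less.prems(1) by (intro card_mono) auto
      also have "\<dots> \<le> s * n" using True by (simp add: card_cartesian_product)
      also have "\<dots> \<le> B * n" by (simp add: B_def)
      finally show ?thesis .
    next
      case False
      define m where "m = n div s + 1"
      define N where "N = (\<lambda>(x, y). (x div s, y div s)) ` M"
      \<comment> \<open>Rounding up to whole blocks adds at most \<open>s\<close>, and
        \<open>s \<le> n\<close> in this case.\<close>
      have ms: "m * s \<le> 2 * n"
      proof -
        have "s * (n div s) \<le> n" by simp
        moreover have "m * s = s * (n div s) + s" by (simp add: m_def)
        ultimately show ?thesis using False by linarith
      qed
      have "2 * (2 * m) \<le> m * s" using s4 by simp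
      with ms have mn: "2 * m \<le> n" by linarith
      then have "m < n" by (simp add: m_def)
      have sub: "N \<subseteq> {..<m} \<times> {..<m}"
      proof -
        have "x div s < m" if "x < n" for x
          using div_le_mono[of x n s] that by (simp add: m_def)
        then show ?thesis using less.prems(1) by (fastforce simp: N_def)
      qed
      have "\<not> matrix_contains k \<pi> N"
        using matrix_contains_contraction[OF \<pi>] less.prems(2) unfolding N_def by blast
      then have IH: "card N \<le> B * m" using less.IH[OF \<open>m < n\<close> sub] by blast
      have s0: "0 < s" using s4 by simp
      have nct: "\<not> matrix_contains k (inv \<pi>) (M\<inverse>)"
        using matrix_contains_transpose[OF \<pi>] less.prems(2) by blast
      have tr: "M\<inverse> \<subseteq> {..<n} \<times> {..<n}" using less.prems(1) by auto
      note w1 = card_wide_blocks[OF \<pi> less.prems(2) k s0 less.prems(1)]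
      note w2 = card_wide_blocks[OF permutes_inv[OF \<pi>] nct k s0 tr]
      have "finite M" using less.prems(1) finite_subset by blast
      note card_blocks_le[OF k s0 this w1(1) w2(1)]
      also have "k\<^sup>2 * card ((\<lambda>(x, y). (x div s, y div s)) ` M) \<le> k\<^sup>2 * (B * m)"
        using IH by (simp add: N_def)
      also have "s\<^sup>2 * (card (wide_blocks k s M) + card (wide_blocks k s (M\<inverse>)))
          \<le> s\<^sup>2 * (m * (2 ^ s * k) + m * (2 ^ s * k))"
        using w1(2) w2(2) unfolding m_def by (intro mult_le_mono2 add_mono)
      also have "\<dots> = A * m" by (simp add: A_def algebra_simps)
      finally have "card M \<le> k\<^sup>2 * (B * m) + A * m" by simp
      moreover have "2 * (k\<^sup>2 * (B * m)) \<le> B * n"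
      proof -
        have "2 * (k\<^sup>2 * m) \<le> n" using ms by (simp add: s_def algebra_simps)
        then have "B * (2 * (k\<^sup>2 * m)) \<le> B * n" by (rule mult_le_mono2)
        then show ?thesis by (simp add: algebra_simps)
      qed
      moreover have "2 * (A * m) \<le> B * n"
      proof -
        have "A * (2 * m) \<le> B * n" using mn by (intro mult_le_mono) (simp_all add: B_def)
        then show ?thesis by (simp add: algebra_simps)
      qed
      ultimately show ?thesis by linarith
    qed
  qed
  then show ?thesis by blast
qed

section \<open>Ordered graphs avoiding the pattern\<close>

text \<open>
  Appending the entry \<open>(k + 1, 1)\<close> to the pattern forces all rows of a copy to precede all of its
  columns, because every edge \<open>(x, y)\<close> of the graph satisfies \<open>x < y\<close>.
\<close>

lemma ordered_graph_linear:
  assumes \<pi>: "\<pi> permutes {1..k}"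
  shows "\<exists>C. \<forall>V G. finite V \<longrightarrow> G \<subseteq> {(x, y). x \<in> V \<and> y \<in> V \<and> x < y} \<longrightarrow>
    \<not> graph_contains k \<pi> G \<longrightarrow> card G \<le> C * card V"
proof -
  \<comment> \<open>The old entries move one column to the right, which frees column 1 for the new
    last row.\<close>
  define \<rho> where "\<rho> i = (if i \<in> {1..k} then Suc (\<pi> i) else if i = Suc k then 1 else i)" for i
  have \<pi>in: "\<pi> i \<in> {1..k} \<longleftrightarrow> i \<in> {1..k}" for i by (rule permutes_in_image[OF \<pi>])
  have "\<rho> permutes {1..Suc k}"
  proof (rule bij_imp_permutes)
    have inj: "inj_on \<rho> {1..Suc k}"
    proof (rule inj_onI)
      fix x y assume xy: "x \<in> {1..Suc k}" "y \<in> {1..Suc k}" "\<rho> x = \<rho> y"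
      have "\<pi> x \<noteq> 0" if "Suc 0 \<le> x" "x \<le> k" using \<pi>in[of x] that by auto
      moreover have "\<pi> y \<noteq> 0" if "Suc 0 \<le> y" "y \<le> k" using \<pi>in[of y] that by auto
      ultimately show "x = y"
        using xy permutes_inj[OF \<pi>] by (auto simp: \<rho>_def inj_eq split: if_splits)
    qed
    moreover have "\<rho> ` {1..Suc k} \<subseteq> {1..Suc k}"
      using \<pi>in by (fastforce simp: \<rho>_def)
    ultimately show "bij_betw \<rho> {1..Suc k} {1..Suc k}"
      by (simp add: bij_betw_def endo_inj_surj)
  qed (auto simp: \<rho>_def)
  then obtain B where B: "\<And>n M. M \<subseteq> {..<n} \<times> {..<n} \<Longrightarrow> \<not> matrix_contains (Suc k) \<rho> M
      \<Longrightarrow> card M \<le> B * n"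
    using marcus_tardos by blast
  have "card G \<le> B * card V"
    if V: "finite V" and G: "G \<subseteq> {(x, y). x \<in> V \<and> y \<in> V \<and> x < y}" and nc: "\<not> graph_contains k \<pi> G"
    for V :: "nat set" and G
  proof -
    \<comment> \<open>Vertices are replaced by their ranks in \<open>V\<close>, so that the bound
      depends on \<open>card V\<close> and not on the size of the labels.\<close>
    obtain h where h: "bij_betw h {..<card V} V" "strict_mono_on {..<card V} h"
      using ex_bij_betw_strict_mono_card[OF V] by metis
    let ?n = "card V"
    define M where "M = {(a, b). a < ?n \<and> b < ?n \<and> (h a, h b) \<in> G}"
    have "G \<subseteq> (\<lambda>(a, b). (h a, h b)) ` M"
    proof clarify
      fix x y assume xy: "(x, y) \<in> G"
      then have "x \<in> h ` {..<?n}" "y \<in> h ` {..<?n}"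
        using G bij_betw_imp_surj_on[OF h(1)] by auto
      then obtain a b where "a < ?n" "b < ?n" "x = h a" "y = h b" by auto
      then show "(x, y) \<in> (\<lambda>(a, b). (h a, h b)) ` M" using xy by (auto simp: M_def)
    qed
    moreover have "finite M" by (rule finite_subset[of _ "{..<?n} \<times> {..<?n}"]) (auto simp: M_def)
    ultimately have "card G \<le> card M" by (meson surj_card_le)
    also have "\<dots> \<le> B * ?n"
    proof (rule B)
      show "M \<subseteq> {..<?n} \<times> {..<?n}" by (auto simp: M_def)
      show "\<not> matrix_contains (Suc k) \<rho> M"
      proof
        assume "matrix_contains (Suc k) \<rho> M"
        then obtain r c where rc: "strict_mono_on {1..Suc k} r" "strict_mono_on {1..Suc k} c"
          "\<forall>i\<in>{1..Suc k}. (r i, c (\<rho> i)) \<in> M"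
          unfolding matrix_contains_def by blast
        have r_lt: "r i < ?n" if "i \<in> {1..Suc k}" for i
          using rc(3) that by (auto simp: M_def)
        have last: "(h (r (Suc k)), h (c 1)) \<in> G" "c 1 < ?n"
          using bspec[OF rc(3), of "Suc k"] by (auto simp: M_def \<rho>_def)
        \<comment> \<open>Membership in \<open>M\<close> bounds only columns of the form
          \<open>c (\<rho> i)\<close>; surjectivity of \<open>\<pi>\<close> shows that these include
          every \<open>c (Suc j)\<close>.\<close>
        have c_lt: "c (Suc j) < ?n" if "j \<in> {1..k}" for j
        proof -
          have "j \<in> \<pi> ` {1..k}" using that permutes_image[OF \<pi>] by simp
          then obtain i where "i \<in> {1..k}" "\<pi> i = j" by (elim imageE) simp
          then show ?thesis using bspec[OF rc(3), of i] by (auto simp: M_def \<rho>_def)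
        qed
        have hr: "h (r i) < h (r (Suc k))" if "i \<in> {1..k}" for i
          using that r_lt by (intro strict_mono_onD[OF h(2)] strict_mono_onD[OF rc(1)]) auto
        have hc: "h (c 1) < h (c (Suc j))" if "j \<in> {1..k}" for j
          using that c_lt last(2) by (intro strict_mono_onD[OF h(2)] strict_mono_onD[OF rc(2)]) auto
        have "h (r (Suc k)) < h (c 1)" using last(1) G by auto
        then have "\<forall>i\<in>{1..k}. \<forall>j\<in>{1..k}. h (r i) < h (c (Suc j))"
          using hr hc by (meson less_trans)
        moreover have "strict_mono_on {1..k} (\<lambda>i. h (r i))"
          using r_lt by (intro strict_mono_onI strict_mono_onD[OF h(2)] strict_mono_onD[OF rc(1)]) auto
        moreover have "strict_mono_on {1..k} (\<lambda>j. h (c (Suc j)))"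
          using c_lt by (intro strict_mono_onI strict_mono_onD[OF h(2)] strict_mono_onD[OF rc(2)]) auto
        moreover have "(h (r i), h (c (Suc (\<pi> i)))) \<in> G" if "i \<in> {1..k}" for i
          using bspec[OF rc(3), of i] that by (auto simp: M_def \<rho>_def)
        ultimately show False using nc unfolding graph_contains_def by blast
      qed
    qed
    finally show ?thesis .
  qed
  then show ?thesis by blast
qed

subsection \<open>Cliques in sparse graphs\<close>

text \<open>Averaging: a degree is at most the out-degree plus the in-degree inside
  \<open>V\<close>, and each of these sums over \<open>V\<close> to the number of edges.\<close>

lemma ex_low_degree_vertex:
  fixes G :: "('a \<times> 'a) set"
  assumes V: "finite V" "V \<noteq> {}" and G: "card (G \<inter> V \<times> V) \<le> C * card V"
  shows "\<exists>v\<in>V. card {u \<in> V. (u, v) \<in> G \<or> (v, u) \<in> G} \<le> 2 * C"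
proof (rule ccontr)
  let ?G = "G \<inter> V \<times> V"
  assume "\<not> ?thesis"
  then have big: "\<And>v. v \<in> V \<Longrightarrow> 2 * C < card {u \<in> V. (u, v) \<in> G \<or> (v, u) \<in> G}" by auto
  have deg: "(\<Sum>v\<in>V. card (R `` {v})) = card R" if "R \<subseteq> V \<times> V" for R
  proof -
    have "R = (SIGMA v:V. R `` {v})" using that by auto
    moreover have "card (SIGMA v:V. R `` {v}) = (\<Sum>v\<in>V. card (R `` {v}))"
      using V that by (intro card_SigmaI ballI) (auto intro: finite_subset[of _ V])
    ultimately show ?thesis by simp
  qed
  have "2 * C * card V = (\<Sum>v\<in>V. 2 * C)" by simp
  also have "\<dots> < (\<Sum>v\<in>V. card {u \<in> V. (u, v) \<in> G \<or> (v, u) \<in> G})"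
    using V big by (intro sum_strict_mono) auto
  also have "\<dots> \<le> (\<Sum>v\<in>V. card (?G `` {v}) + card (?G\<inverse> `` {v}))"
  proof (rule sum_mono)
    fix v assume "v \<in> V"
    then have "{u \<in> V. (u, v) \<in> G \<or> (v, u) \<in> G} = ?G `` {v} \<union> ?G\<inverse> `` {v}" by auto
    then show "card {u \<in> V. (u, v) \<in> G \<or> (v, u) \<in> G} \<le> card (?G `` {v}) + card (?G\<inverse> `` {v})"
      by (simp add: card_Un_le)
  qed
  also have "\<dots> = card ?G + card (?G\<inverse>)"
    by (subst sum.distrib, subst deg, blast, subst deg) auto
  also have "\<dots> = 2 * card ?G" by (simp add: card_inverse)
  finally show False using G by simp
qed

text \<open>Edges are stored as increasing pairs, so only these are tested. The empty set and
  singletons count as cliques.\<close>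

definition clique_in :: "('a::linorder \<times> 'a) set \<Rightarrow> 'a set \<Rightarrow> bool" where
  "clique_in G E \<longleftrightarrow> (\<forall>x\<in>E. \<forall>y\<in>E. x < y \<longrightarrow> (x, y) \<in> G)"

text \<open>Remove a vertex \<open>v\<close> with at most \<open>2 * C\<close> neighbours: a clique
  through \<open>v\<close> is \<open>v\<close> together with a subset of its neighbours, and all
  others survive in \<open>V - {v}\<close>. Sparsity is assumed for all vertex sets so that it
  persists after removals; leaving out the empty clique makes the count start at 0.\<close>

lemma cliques_sparse_graph:
  fixes G :: "('a::linorder \<times> 'a) set"
  assumes sparse: "\<And>U. finite U \<Longrightarrow> card (G \<inter> U \<times> U) \<le> C * card U" and V: "finite V"
  shows "card {E. E \<subseteq> V \<and> E \<noteq> {} \<and> clique_in G E} \<le> 2 ^ (2 * C) * card V \<and>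
    (\<forall>E. E \<subseteq> V \<longrightarrow> clique_in G E \<longrightarrow> card E \<le> 2 * C + 1)"
  using V
proof (induction "card V" arbitrary: V)
  case 0
  then have "V = {}" by simp
  moreover have "{E. E \<subseteq> {} \<and> E \<noteq> {} \<and> clique_in G E} = {}" by auto
  ultimately show ?case by simp
next
  case (Suc n)
  let ?K = "\<lambda>V. {E. E \<subseteq> V \<and> E \<noteq> {} \<and> clique_in G E}"
  have "V \<noteq> {}" using Suc by auto
  then obtain v where v: "v \<in> V" "card {u \<in> V. (u, v) \<in> G \<or> (v, u) \<in> G} \<le> 2 * C"
    using ex_low_degree_vertex[OF Suc.prems _ sparse[OF Suc.prems]] by blast
  define N where "N = {u \<in> V. (u, v) \<in> G \<or> (v, u) \<in> G}"
  have N: "finite N" "card N \<le> 2 * C" using v Suc.prems by (auto simp: N_def)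
  have cV: "card (V - {v}) = n" using v Suc by simp
  note IH = Suc.hyps(1)[OF cV[symmetric] finite_Diff[OF Suc.prems]]
  have nbr: "E - {v} \<subseteq> N" if "E \<subseteq> V" "clique_in G E" "v \<in> E" for E
  proof
    fix u assume "u \<in> E - {v}"
    then show "u \<in> N"
      using that by (cases u v rule: linorder_cases) (auto simp: N_def clique_in_def)
  qed
  have "?K V \<subseteq> ?K (V - {v}) \<union> insert v ` Pow N"
  proof
    fix E assume E: "E \<in> ?K V"
    show "E \<in> ?K (V - {v}) \<union> insert v ` Pow N"
    proof (cases "v \<in> E")
      case True
      then have "E = insert v (E - {v})" by auto
      then show ?thesis using nbr[of E] E True by blast
    qed (use E in auto)
  qed
  moreover have "finite (?K (V - {v}))"
    by (rule finite_subset[of _ "Pow V"]) (use Suc.prems in auto)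
  ultimately have "card (?K V) \<le> card (?K (V - {v}) \<union> insert v ` Pow N)"
    using N(1) by (intro card_mono) auto
  also have "\<dots> \<le> card (?K (V - {v})) + card (insert v ` Pow N)" by (rule card_Un_le)
  also have "card (?K (V - {v})) \<le> 2 ^ (2 * C) * n" using IH cV by simp
  also have "card (insert v ` Pow N) \<le> 2 ^ (2 * C)"
  proof -
    have "card (insert v ` Pow N) \<le> card (Pow N)" using N(1) by (intro card_image_le) simp
    also have "\<dots> \<le> 2 ^ (2 * C)" using N by (simp add: card_Pow)
    finally show ?thesis .
  qed
  finally have "card (?K V) \<le> 2 ^ (2 * C) * card V"
    by (simp add: Suc.hyps(2)[symmetric])
  moreover have "card E \<le> 2 * C + 1" if E: "E \<subseteq> V" "clique_in G E" for E
  proof (cases "v \<in> E")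
    case True
    have "card (E - {v}) \<le> card N" using nbr[OF E True] N(1) by (intro card_mono)
    then show ?thesis using N(2) card_Diff_singleton[OF True] by linarith
  next
    case False
    then show ?thesis using IH E by blast
  qed
  ultimately show ?case by blast
qed

subsection \<open>Hypergraphs\<close>

text \<open>Greedy choice: when the next set must supply an element, fewer than \<open>k\<close>
  values are taken.\<close>

lemma distinct_representatives:
  assumes "finite I" "card I \<le> k" "\<And>i. i \<in> I \<Longrightarrow> finite (S i) \<and> k \<le> card (S i)"
  obtains e where "inj_on e I" "\<And>i. i \<in> I \<Longrightarrow> e i \<in> S i"
proof -
  have "\<exists>e. inj_on e I \<and> (\<forall>i\<in>I. e i \<in> S i)"
    using assms
  proof (induction I rule: finite_induct)
    case (insert a I)
    then obtain e where e: "inj_on e I" "\<forall>i\<in>I. e i \<in> S i" by auto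
    have "card (e ` I) < card (S a)"
      using insert card_image_le[OF insert.hyps(1), of e] by fastforce
    then have "\<not> S a \<subseteq> e ` I"
      using card_mono[of "e ` I" "S a"] insert.hyps(1) by auto
    then obtain z where z: "z \<in> S a" "z \<notin> e ` I" by blast
    have "e(a := z) ` I = e ` I" using insert.hyps(2) by (auto simp: image_def)
    moreover have "inj_on (e(a := z)) I" using e(1) insert.hyps(2) by (auto simp: inj_on_def)
    ultimately have "inj_on (e(a := z)) (insert a I)"
      using z insert.hyps(2) by (auto simp: inj_on_insert)
    moreover have "\<forall>i\<in>insert a I. (e(a := z)) i \<in> S i" using e(2) z by auto
    ultimately show ?case by blast
  qed auto
  then show ?thesis using that by blast
qed

text \<open>The maps \<open>r\<close> and \<open>c\<close> are glued into one map on [2k]; that rows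
  precede columns makes it increasing across the junction at \<open>k\<close>.\<close>

lemma contained_perm_graphI:
  assumes \<pi>: "\<pi> permutes {1..k}"
    and rc: "strict_mono_on {1..k} r" "strict_mono_on {1..k} c"
      "\<forall>i\<in>{1..k}. \<forall>j\<in>{1..k}. r i < c j"
    and e: "inj_on e {1..k}" "e ` {1..k} \<subseteq> idx H"
      "\<And>i. i \<in> {1..k} \<Longrightarrow> r i \<in> edge H (e i) \<and> c (\<pi> i) \<in> edge H (e i)"
  shows "contained (perm_graph k \<pi>) H"
proof -
  define f where "f t = (if t \<le> k then r t else c (t - k))" for t
  have \<pi>in: "1 \<le> \<pi> i" if "i \<in> {1..k}" for i
    using permutes_in_image[OF \<pi>, of i] that by simp
  have edges: "f ` {i, k + \<pi> i} \<subseteq> edge H (e i)" if "i \<in> {1..k}" for i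
    using e(3)[OF that] \<pi>in[OF that] that by (auto simp: f_def)
  have "strict_mono_on {1..2 * k} f"
  proof (rule strict_mono_onI)
    fix a b assume ab: "a \<in> {1..2 * k}" "b \<in> {1..2 * k}" "a < b"
    consider "b \<le> k" | "a \<le> k" "k < b" | "k < a" using ab(3) by linarith
    then show "f a < f b"
    proof cases
      case 1
      with ab show ?thesis by (auto simp: f_def intro!: strict_mono_onD[OF rc(1)])
    next
      case 2
      with ab have "a \<in> {1..k}" "b - k \<in> {1..k}" by auto
      with rc(3) have "r a < c (b - k)" by blast
      with 2 show ?thesis by (simp add: f_def)
    next
      case 3
      with ab show ?thesis by (auto simp: f_def intro!: strict_mono_onD[OF rc(2)])
    qed
  qed
  moreover have "f ` vertices (perm_graph k \<pi>) \<subseteq> vertices H"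
  proof -
    have "vertices (perm_graph k \<pi>) = (\<Union>i\<in>{1..k}. {i, k + \<pi> i})"
      by (simp add: vertices_def perm_graph_def)
    then have "f ` vertices (perm_graph k \<pi>) = (\<Union>i\<in>{1..k}. f ` {i, k + \<pi> i})"
      by (simp only: image_UN)
    also have "\<dots> \<subseteq> (\<Union>i\<in>{1..k}. edge H (e i))" using edges by (intro UN_mono) auto
    also have "\<dots> \<subseteq> vertices H" using e(2) unfolding vertices_def by blast
    finally show ?thesis .
  qed
  moreover have "\<forall>i\<in>idx (perm_graph k \<pi>). f ` edge (perm_graph k \<pi>) i \<subseteq> edge H (e i)"
    using edges by (simp add: perm_graph_def)
  ultimately show ?thesis
    unfolding contained_def perm_graph_hypergraph(3)[OF \<pi>]
    using e(1,2) by (intro exI[of _ f] exI[of _ e]) (simp add: perm_graph_def)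
qed

section \<open>Cutting a hyperedge into consecutive pieces\<close>

lemma ex_initial_part:
  fixes E :: "nat set"
  assumes "finite E" "d \<le> card E"
  obtains D where "D \<subseteq> E" "card D = d" "\<And>x y. x \<in> D \<Longrightarrow> y \<in> E - D \<Longrightarrow> x < y"
proof -
  obtain h where h: "bij_betw h {..<card E} E" "strict_mono_on {..<card E} h"
    using ex_bij_betw_strict_mono_card[OF assms(1)] by metis
  have inj: "inj_on h {..<card E}" and img: "h ` {..<card E} = E"
    using h(1) by (auto simp: bij_betw_def)
  show ?thesis
  proof (rule that)
    show "h ` {..<d} \<subseteq> E" using img assms(2) by auto
    have "inj_on h {..<d}" by (rule inj_on_subset[OF inj]) (use assms(2) in auto)
    then show "card (h ` {..<d}) = d" by (simp add: card_image)
    fix x y assume x: "x \<in> h ` {..<d}" and y: "y \<in> E - h ` {..<d}"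
    from x obtain a where a: "a < d" "x = h a" by auto
    from y img have "y \<in> h ` {..<card E}" by auto
    then obtain b where b: "b < card E" "y = h b" by auto
    have "d \<le> b" using y b by (meson DiffE imageI lessThan_iff not_less)
    then show "x < y" using a b assms(2) by (auto intro!: strict_mono_onD[OF h(2)])
  qed
qed

text \<open>Incompatible with a copy of the pattern, where the first component of each pair lies
  below the second component of every other pair.\<close>

definition separated :: "nat \<times> nat \<Rightarrow> nat \<times> nat \<Rightarrow> bool" where
  "separated p q \<longleftrightarrow> snd p < fst q \<or> snd q < fst p"

text \<open>Cut off the \<open>d\<close> smallest elements, take a pair of \<open>Q\<close> among
  them, and continue with the rest, which lies entirely above that pair. Fewer than \<open>d\<close>
  elements remain at the end, whence the \<open>+ 1\<close>.\<close>

lemma ex_separated_pairs: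
  fixes E :: "nat set"
  assumes "finite E" "0 < d" and "\<And>D. D \<subseteq> E \<Longrightarrow> card D = d \<Longrightarrow> Q \<inter> D \<times> D \<noteq> {}"
  shows "\<exists>L. L \<subseteq> Q \<inter> E \<times> E \<and> pairwise separated L \<and> card E < d * (card L + 1)"
  using assms
proof (induction "card E" arbitrary: E rule: less_induct)
  case less
  show ?case
  proof (cases "card E < d")
    case True
    then show ?thesis by (intro exI[of _ "{}"]) simp
  next
    case False
    then obtain D where D: "D \<subseteq> E" "card D = d" "\<And>x y. x \<in> D \<Longrightarrow> y \<in> E - D \<Longrightarrow> x < y"
      using ex_initial_part[OF less.prems(1), of d] by auto
    obtain x y where p: "(x, y) \<in> Q" "x \<in> D" "y \<in> D" using less.prems(3)[OF D(1,2)] by auto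
    have cE: "card (E - D) + d = card E"
      using card_Diff_subset[of D E] card_mono[OF less.prems(1) D(1)] finite_subset[OF D(1)] D(1,2)
        less.prems(1) by simp
    then have "card (E - D) < card E" using less.prems(2) by simp
    moreover have "\<And>D'. D' \<subseteq> E - D \<Longrightarrow> card D' = d \<Longrightarrow> Q \<inter> D' \<times> D' \<noteq> {}"
      by (rule less.prems(3)) auto
    ultimately obtain L where L: "L \<subseteq> Q \<inter> (E - D) \<times> (E - D)" "pairwise separated L"
      "card (E - D) < d * (card L + 1)"
      using less.hyps[of "E - D"] less.prems(1,2) by auto
    have "finite ((E - D) \<times> (E - D))" using less.prems(1) by simp
    then have fin: "finite L" using L(1) finite_subset[of L "(E - D) \<times> (E - D)"] by simp
    have new: "(x, y) \<notin> L" using L(1) p by auto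
    have "pairwise separated (insert (x, y) L)"
      unfolding pairwise_insert
    proof (intro conjI allI impI)
      fix q assume "q \<in> L \<and> q \<noteq> (x, y)"
      then have "y < fst q" using L(1) D(3)[OF p(3), of "fst q"] by auto
      then show "separated (x, y) q" "separated q (x, y)" by (auto simp: separated_def)
    qed (rule L(2))
    moreover have "insert (x, y) L \<subseteq> Q \<inter> E \<times> E" using L(1) p D(1) by auto
    moreover have "card E < d * (card (insert (x, y) L) + 1)"
      using L(3) cE fin new by simp
    ultimately show ?thesis by blast
  qed
qed

section \<open>The linear bound on the weight\<close>

lemma weight_linear:
  assumes \<pi>: "\<pi> permutes {1..k}"
  shows "\<exists>C. \<forall>H. hypergraph H \<longrightarrow> simple H \<longrightarrow> avoids H (perm_graph k \<pi>) \<longrightarrow>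
    weight H \<le> C * order H"
proof -
  obtain C where C: "\<And>V G. finite V \<Longrightarrow> G \<subseteq> {(x, y). x \<in> V \<and> y \<in> V \<and> x < y} \<Longrightarrow>
    \<not> graph_contains k \<pi> G \<Longrightarrow> card G \<le> C * card V"
    using ordered_graph_linear[OF \<pi>] by blast
  \<comment> \<open>One more than the largest possible size of a clique of heavy pairs, so every
    piece of \<open>d\<close> vertices contains a light pair.\<close>
  define d where "d = 2 * C + 2"
  \<comment> \<open>The first summand pays for the hyperedges containing a light pair, the second
    for the cliques: at most 2^(2C) per vertex, each of size at most 2C + 1.\<close>
  have "weight H \<le> (2 * d * k * C + (2 * C + 1) * 2 ^ (2 * C)) * order H"
    if H: "hypergraph H" "simple H" "avoids H (perm_graph k \<pi>)" for H
  proof -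
    define V where "V = vertices H"
    define N where "N x y = {e \<in> idx H. x \<in> edge H e \<and> y \<in> edge H e}" for x y
    define G where "G = {(x, y). x \<in> V \<and> y \<in> V \<and> x < y \<and> k \<le> card (N x y)}"
    define Q where "Q = {(x, y). x \<in> V \<and> y \<in> V \<and> x < y \<and> card (N x y) < k}"
    define J where "J = {e \<in> idx H. \<not> clique_in G (edge H e)}"
    have finI: "finite (idx H)" and finE: "\<And>e. e \<in> idx H \<Longrightarrow> finite (edge H e)"
      and neE: "\<And>e. e \<in> idx H \<Longrightarrow> edge H e \<noteq> {}"
      using H(1) by (auto simp: hypergraph_def)
    have finV: "finite V" using finI finE by (auto simp: V_def vertices_def)
    have EV: "edge H e \<subseteq> V" if "e \<in> idx H" for e using that by (auto simp: V_def vertices_def)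
    have finN: "finite (N x y)" for x y using finI by (simp add: N_def)
    have finJ: "finite J" using finI by (simp add: J_def)

    have G_avoids: "\<not> graph_contains k \<pi> G"
    proof
      assume "graph_contains k \<pi> G"
      then obtain r c where rc: "strict_mono_on {1..k} r" "strict_mono_on {1..k} c"
        "\<forall>i\<in>{1..k}. \<forall>j\<in>{1..k}. r i < c j" "\<forall>i\<in>{1..k}. (r i, c (\<pi> i)) \<in> G"
        unfolding graph_contains_def by blast
      have heavy: "\<And>i. i \<in> {1..k} \<Longrightarrow> finite (N (r i) (c (\<pi> i))) \<and> k \<le> card (N (r i) (c (\<pi> i)))"
        using rc(4) finN by (simp add: G_def)
      obtain e where e: "inj_on e {1..k}" "\<And>i. i \<in> {1..k} \<Longrightarrow> e i \<in> N (r i) (c (\<pi> i))"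
        using distinct_representatives[of "{1..k}" k "\<lambda>i. N (r i) (c (\<pi> i))"] heavy by auto
      have "contained (perm_graph k \<pi>) H"
        by (rule contained_perm_graphI[OF \<pi> rc(1-3) e(1)]) (use e(2) in \<open>auto simp: N_def\<close>)
      then show False using H(3) by (simp add: avoids_def)
    qed
    \<comment> \<open>Avoidance passes to subgraphs, which gives the bound on every vertex set, as
      degeneracy requires.\<close>
    have sparse: "card (G \<inter> U \<times> U) \<le> C * card U" if "finite U" for U
    proof (rule C[OF that])
      show "G \<inter> U \<times> U \<subseteq> {(x, y). x \<in> U \<and> y \<in> U \<and> x < y}" by (auto simp: G_def)
      show "\<not> graph_contains k \<pi> (G \<inter> U \<times> U)"
        using G_avoids unfolding graph_contains_def by blast
    qed
    note cliques = cliques_sparse_graph[OF sparse finV]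

    have "\<exists>L. L \<subseteq> Q \<inter> edge H e \<times> edge H e \<and> pairwise separated L \<and>
      card (edge H e) \<le> 2 * d * card L" if e: "e \<in> J" for e
    proof -
      have eI: "e \<in> idx H" using e by (simp add: J_def)
      have light: "Q \<inter> D \<times> D \<noteq> {}" if D: "D \<subseteq> edge H e" "\<not> clique_in G D" for D
      proof -
        obtain x y where xy: "x \<in> D" "y \<in> D" "x < y" "(x, y) \<notin> G"
          using D(2) unfolding clique_in_def by blast
        moreover have "x \<in> V" "y \<in> V" using xy(1,2) D(1) EV[OF eI] by blast+
        ultimately have "(x, y) \<in> Q" by (simp add: G_def Q_def)
        then show ?thesis using xy(1,2) by blast
      qed
      have "\<not> clique_in G D" if "D \<subseteq> edge H e" "card D = d" for D
      proof
        assume "clique_in G D"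
        moreover have "D \<subseteq> V" using that(1) EV[OF eI] by blast
        ultimately have "card D \<le> 2 * C + 1" using cliques by blast
        then show False using that(2) by (simp add: d_def)
      qed
      then obtain L where L: "L \<subseteq> Q \<inter> edge H e \<times> edge H e" "pairwise separated L"
        "card (edge H e) < d * (card L + 1)"
        using ex_separated_pairs[OF finE[OF eI], of d Q] light by (auto simp: d_def)
      show ?thesis
      proof (cases "card L = 0")
        case True
        \<comment> \<open>The cutting may yield no pair from a hyperedge with fewer than
          \<open>d\<close> vertices. It is not a clique, so one light pair of its own replaces the
          empty choice.\<close>
        obtain p where "p \<in> Q \<inter> edge H e \<times> edge H e"
          using light[of "edge H e"] e by (auto simp: J_def)
        then show ?thesis using True L(3) by (intro exI[of _ "{p}"]) auto
      next
        case False
        then have "d * (card L + 1) \<le> d * (2 * card L)" by (intro mult_le_mono2) simp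
        also have "\<dots> = 2 * d * card L" by simp
        finally have "card (edge H e) \<le> 2 * d * card L" using L(3) by linarith
        then show ?thesis using L(1,2) by blast
      qed
    qed
    then obtain L where L: "\<And>e. e \<in> J \<Longrightarrow> L e \<subseteq> Q \<inter> edge H e \<times> edge H e"
      "\<And>e. e \<in> J \<Longrightarrow> pairwise separated (L e)"
      "\<And>e. e \<in> J \<Longrightarrow> card (edge H e) \<le> 2 * d * card (L e)"
      by metis
    define P where "P = (\<Union>e\<in>J. L e)"
    have PQ: "P \<subseteq> Q" using L(1) by (auto simp: P_def)
    have "\<not> graph_contains k \<pi> P"
    proof
      assume "graph_contains k \<pi> P"
      then obtain r c where rc: "strict_mono_on {1..k} r" "strict_mono_on {1..k} c"
        "\<forall>i\<in>{1..k}. \<forall>j\<in>{1..k}. r i < c j" "\<forall>i\<in>{1..k}. (r i, c (\<pi> i)) \<in> P"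
        unfolding graph_contains_def by blast
      from rc(4) have "\<forall>i\<in>{1..k}. \<exists>e. e \<in> J \<and> (r i, c (\<pi> i)) \<in> L e" by (simp add: P_def Bex_def)
      then obtain e where e: "\<And>i. i \<in> {1..k} \<Longrightarrow> e i \<in> J \<and> (r i, c (\<pi> i)) \<in> L (e i)"
        by metis
      have \<pi>in: "\<And>i. i \<in> {1..k} \<Longrightarrow> \<pi> i \<in> {1..k}" using permutes_in_image[OF \<pi>] by blast
      have "inj_on e {1..k}"
      proof (rule inj_onI, rule ccontr)
        fix i j assume ij: "i \<in> {1..k}" "j \<in> {1..k}" "e i = e j" "i \<noteq> j"
        \<comment> \<open>The two pairs must be known to differ before pairwise separation applies
          to them.\<close>
        have "r i \<noteq> r j" using strict_mono_on_imp_inj_on[OF rc(1)] ij by (auto dest: inj_onD)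
        then have "separated (r i, c (\<pi> i)) (r j, c (\<pi> j))"
          using L(2)[of "e i"] e[OF ij(1)] e[OF ij(2)] ij(3) by (auto simp: pairwise_def)
        moreover have "r j < c (\<pi> i)" "r i < c (\<pi> j)" using rc(3) \<pi>in ij(1,2) by blast+
        ultimately show False by (simp add: separated_def)
      qed
      then have "contained (perm_graph k \<pi>) H"
      proof (rule contained_perm_graphI[OF \<pi> rc(1-3)])
        show "e ` {1..k} \<subseteq> idx H" using e by (auto simp: J_def)
        show "r i \<in> edge H (e i) \<and> c (\<pi> i) \<in> edge H (e i)" if "i \<in> {1..k}" for i
          using e[OF that] L(1)[of "e i"] by auto
      qed
      then show False using H(3) by (simp add: avoids_def)
    qed
    moreover have "P \<subseteq> {(x, y). x \<in> V \<and> y \<in> V \<and> x < y}" using PQ by (auto simp: Q_def)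
    ultimately have cardP: "card P \<le> C * card V" using C[OF finV] by blast
    have finP: "finite P"
      by (rule finite_subset[of _ "V \<times> V"]) (use PQ finV in \<open>auto simp: Q_def\<close>)

    have "(\<Sum>e\<in>J. card (edge H e)) \<le> (\<Sum>e\<in>J. 2 * d * card (L e))" by (intro sum_mono L(3))
    also have "\<dots> = 2 * d * (\<Sum>e\<in>J. card {p \<in> P. p \<in> L e})"
    proof -
      have "{p \<in> P. p \<in> L e} = L e" if "e \<in> J" for e using that by (auto simp: P_def)
      then show ?thesis by (simp add: sum_distrib_left)
    qed
    \<comment> \<open>Double counting of incidences between hyperedges and picked pairs: a picked
      pair is light, so fewer than \<open>k\<close> hyperedges contain it.\<close>
    also have "(\<Sum>e\<in>J. card {p \<in> P. p \<in> L e}) = (\<Sum>p\<in>P. card {e \<in> J. p \<in> L e})"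
      using finJ finP by (intro sum_multicount_gen) auto
    also have "\<dots> \<le> (\<Sum>p\<in>P. k)"
    proof (rule sum_mono)
      fix p assume "p \<in> P"
      obtain x y where p: "p = (x, y)" by fastforce
      have "{e \<in> J. p \<in> L e} \<subseteq> N x y" using L(1) by (auto simp: J_def N_def p)
      then have "card {e \<in> J. p \<in> L e} \<le> card (N x y)" by (intro card_mono finN)
      also have "\<dots> < k" using PQ \<open>p \<in> P\<close> by (auto simp: Q_def p)
      finally show "card {e \<in> J. p \<in> L e} \<le> k" by simp
    qed
    also have "\<dots> \<le> k * (C * card V)" using cardP by simp
    finally have wJ: "(\<Sum>e\<in>J. card (edge H e)) \<le> 2 * d * k * C * card V"
      by (simp add: algebra_simps)

    have "(\<Sum>e\<in>idx H - J. card (edge H e)) \<le> (\<Sum>e\<in>idx H - J. 2 * C + 1)"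
      using cliques EV by (intro sum_mono) (auto simp: J_def)
    also have "\<dots> = card (idx H - J) * (2 * C + 1)" by simp
    also have "\<dots> \<le> 2 ^ (2 * C) * card V * (2 * C + 1)"
    proof (rule mult_le_mono1)
      \<comment> \<open>Simplicity of \<open>H\<close> enters here: different indices give different
        cliques, so counting cliques bounds the number of indices.\<close>
      have "card (idx H - J) \<le> card {E. E \<subseteq> V \<and> E \<noteq> {} \<and> clique_in G E}"
      proof (rule card_inj_on_le)
        show "inj_on (edge H) (idx H - J)"
          using H(2) by (auto simp: simple_def intro: inj_on_subset)
        show "edge H ` (idx H - J) \<subseteq> {E. E \<subseteq> V \<and> E \<noteq> {} \<and> clique_in G E}"
          using EV neE by (auto simp: J_def)
        show "finite {E. E \<subseteq> V \<and> E \<noteq> {} \<and> clique_in G E}"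
          by (rule finite_subset[of _ "Pow V"]) (use finV in auto)
      qed
      then show "card (idx H - J) \<le> 2 ^ (2 * C) * card V" using cliques by linarith
    qed
    finally have wC: "(\<Sum>e\<in>idx H - J. card (edge H e)) \<le> 2 ^ (2 * C) * card V * (2 * C + 1)" .
    have "weight H = (\<Sum>e\<in>idx H - J. card (edge H e)) + (\<Sum>e\<in>J. card (edge H e))"
      unfolding weight_def by (rule sum.subset_diff) (use finI in \<open>auto simp: J_def\<close>)
    also have "\<dots> \<le> 2 ^ (2 * C) * card V * (2 * C + 1) + 2 * d * k * C * card V"
      using wC wJ by (rule add_mono)
    also have "\<dots> = (2 * d * k * C + (2 * C + 1) * 2 ^ (2 * C)) * order H"
      by (simp add: order_def V_def algebra_simps)
    finally show ?thesis .
  qed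
  then show ?thesis by blast
qed

text \<open>The first claim follows from the bound in terms of \<open>order H\<close> by
  monotonicity, the second by taking the maximum over the finite set \<open>ex_weights\<close> when
  it is nonempty.\<close>

theorem theorem1:
  fixes k :: nat and \<pi> :: "nat \<Rightarrow> nat"
  assumes "\<pi> permutes {1..k}"
  shows "(\<exists>C::real. \<forall>n\<ge>1. \<forall>H. hypergraph H \<and> simple H \<and> order H \<le> n \<and> avoids H (perm_graph k \<pi>)
             \<longrightarrow> real (weight H) \<le> C * real n)
       \<and> (\<lambda>n. real (ex_i n (perm_graph k \<pi>))) \<in> O(\<lambda>n. real n)"
proof -
  obtain C where C: "\<And>H. hypergraph H \<Longrightarrow> simple H \<Longrightarrow> avoids H (perm_graph k \<pi>) \<Longrightarrow>
    weight H \<le> C * order H"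
    using weight_linear[OF assms] by blast
  have bound: "weight H \<le> C * n"
    if "hypergraph H" "simple H" "order H \<le> n" "avoids H (perm_graph k \<pi>)" for H n
    using C[OF that(1,2,4)] mult_le_mono2[OF that(3), of C] by linarith
  \<comment> \<open>For \<open>k = 0\<close> nothing avoids the pattern, and \<open>ex_i\<close> takes the unspecified value \<open>Max {}\<close>.\<close>
  define c where "c = max C (Max {})"
  have "ex_i n (perm_graph k \<pi>) \<le> c * n" if "n \<ge> 1" for n
  proof (cases "ex_weights n (perm_graph k \<pi>) = {}")
    case True
    have "c \<le> c * n" using that by simp
    then show ?thesis using True by (simp add: ex_i_def c_def)
  next
    case False
    have "ex_i n (perm_graph k \<pi>) \<le> C * n"
      unfolding ex_i_def using bound False
      by (subst Max_le_iff[OF finite_ex_weights]) (auto simp: ex_weights_def)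
    also have "\<dots> \<le> c * n" by (simp add: c_def)
    finally show ?thesis .
  qed
  then have "real (ex_i n (perm_graph k \<pi>)) \<le> real c * real n" if "n \<ge> 1" for n
    using that by (metis of_nat_le_iff of_nat_mult)
  then have "(\<lambda>n. real (ex_i n (perm_graph k \<pi>))) \<in> O(\<lambda>n. real n)"
    by (intro bigoI[of _ "real c"] eventually_sequentiallyI[of 1]) simp
  moreover have "\<forall>n\<ge>1. \<forall>H. hypergraph H \<and> simple H \<and> order H \<le> n \<and> avoids H (perm_graph k \<pi>)
      \<longrightarrow> real (weight H) \<le> real C * real n"
    using bound by (metis of_nat_le_iff of_nat_mult)
  ultimately show ?thesis by blast
qed

end
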